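(* Let $\chi=\log(\rho/p)$, i.e. $\rho/p=\exp\chi$. For the two-dimensional Euler equations, define two-point numerical fluxes (for all pairs of states with $\rho,p>0$) by $$f^{x}_{\rho}=\{\{\rho\}\}_{\log}\{\{v_x\}\},\quad f^x_{\rho v_x}=\{\{v_x\}\}f^x_\rho+\frac{\{\{\rho\}\}}{\{\{\rho/p\}\}},\quad f^x_{\rho v_y}=\{\{v_y\}\}f^x_\rho,$$ $$f^x_{\rho e}=\left(\frac{1}{\gamma-1}\frac{1}{\exp\{\{\chi\}\}_{x\mapsto \exp x}}-\frac{\{\{v_x^2\}\}+\{\{v_y^2\}\}}{2}\right)f^x_\rho+\{\{v_x\}\}f^x_{\rho v_x}+\{\{v_y\}\}f^x_{\rho v_y},$$ and $$f^{y}_{\rho}=\{\{\rho\}\}_{\log}\{\{v_y\}\},\quad f^y_{\rho v_x}=\{\{v_x\}\}f^y_\rho,\quad f^y_{\rho v_y}=\{\{v_y\}\}f^y_\rho+\frac{\{\{\rho\}\}}{\{\{\rho/p\}\}},$$ $$f^y_{\rho e}=\left(\frac{1}{\gamma-1}\frac{1}{\exp\{\{\chi\}\}_{x\mapsto \exp x}}-\frac{\{\{v_x^2\}\}+\{\{v_y^2\}\}}{2}\right)f^y_\rho+\{\{v_x\}\}f^y_{\rho v_x}+\{\{v_y\}\}f^y_{\rho v_y}.$$ These fluxes are entropy conservative, kinetic energy preserving, and consistent.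
   Context: Euler equations: $\partial_tu+\partial_xf_x(u)+\partial_yf_y(u)=0$, $u=(\rho,\rho v_x,\rho v_y,\rho e)^T$, $f_x=(\rho v_x,\rho v_x^2+p,\rho v_xv_y,(\rho e+p)v_x)^T$, $f_y=(\rho v_y,\rho v_xv_y,\rho v_y^2+p,(\rho e+p)v_y)^T$, $p=(\gamma-1)(\rho e-\frac12\rho v^2)$, $v^2=v_x^2+v_y^2$, $\gamma>1$ constant, $\rho,p>0$. With $s=\log(p/\rho^\gamma)$, the entropy is $U=-\rho s/(\gamma-1)$, the entropy variables are $w=\left(\frac{\gamma}{\gamma-1}-\frac{s}{\gamma-1}-\frac{\rho v^2}{2p},\frac{\rho v_x}{p},\frac{\rho v_y}{p},-\frac{\rho}{p}\right)^T$ and the flux potentials are $\psi_x=\rho v_x$, $\psi_y=\rho v_y$. Means of a quantity $a$ with values $a_-,a_+$ at the states $u_-,u_+$: $\{\{a\}\}=\frac{a_-+a_+}2$; for $a_\pm>0$, $\{\{a\}\}_{\log}=\frac{a_+-a_-}{\log a_+-\log a_-}$ (and $=a$ if $a_-=a_+=a$). Moreover $\{\{\chi\}\}_{x\mapsto\exp x}=\log\frac{\exp\chi_+-\exp\chi_-}{\chi_+-\chi_-}$ (and $=\chi$ if $\chi_-=\chi_+=\chi$). A two-point flux $f^j=(f^j_\rho,f^j_{\rho v_x},f^j_{\rho v_y},f^j_{\rho e})^T(u_-,u_+)$, $j\in\{x,y\}$, is consistent if $f^j(u,u)=f_j(u)$; entropy conservative if $(w_+-w_-)\cdot f^j(u_-,u_+)-(\psi_{j,+}-\psi_{j,-})=0$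 for all pairs of states; kinetic energy preserving if $f^j_{\rho v_j}=\{\{v_j\}\}f^j_\rho+p^{\mathrm{num}}$ with $p^{\mathrm{num}}$ a consistent approximation of the pressure, i.e. $p^{\mathrm{num}}(u,u)=p$ (here $p^{\mathrm{num}}=\{\{\rho\}\}/\{\{\rho/p\}\}$). *)

theory Defs
  imports "HOL-Analysis.Analysis"
begin

text \<open>A state is the vector of conserved variables
  \<open>(\<rho>, \<rho> v\<^sub>x, \<rho> v\<^sub>y, \<rho> e)\<close>; velocities and pressure are derived from it.
  The parameter \<open>\<gamma>\<close> is the ratio of specific heats.\<close>

type_synonym state = "real ^ 4"

type_synonym two_point_flux = "state \<Rightarrow> state \<Rightarrow> state"

datatype direction = Dir_x | Dir_y

definition density :: "state \<Rightarrow> real"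
  where "density u = u $ 1"

definition velocity_x :: "state \<Rightarrow> real"
  where "velocity_x u = u $ 2 / u $ 1"

definition velocity_y :: "state \<Rightarrow> real"
  where "velocity_y u = u $ 3 / u $ 1"

definition speed_sq :: "state \<Rightarrow> real"
  where "speed_sq u = (velocity_x u)\<^sup>2 + (velocity_y u)\<^sup>2"

definition pressure :: "real \<Rightarrow> state \<Rightarrow> real"
  where "pressure \<gamma> u = (\<gamma> - 1) * (u $ 4 - 1 / 2 * density u * speed_sq u)"

definition admissible :: "real \<Rightarrow> state set"
  where "admissible \<gamma> = {u. density u > 0 \<and> pressure \<gamma> u > 0}"

fun velocity :: "direction \<Rightarrow> state \<Rightarrow> real"
  where
    "velocity Dir_x u = velocity_x u"
  | "velocity Dir_y u = velocity_y u"

fun momentum_component :: "direction \<Rightarrow> state \<Rightarrow> real"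
  where
    "momentum_component Dir_x f = f $ 2"
  | "momentum_component Dir_y f = f $ 3"

fun euler_flux :: "real \<Rightarrow> direction \<Rightarrow> state \<Rightarrow> state"
  where
    "euler_flux \<gamma> Dir_x u = vector
       [density u * velocity_x u,
        density u * (velocity_x u)\<^sup>2 + pressure \<gamma> u,
        density u * velocity_x u * velocity_y u,
        (u $ 4 + pressure \<gamma> u) * velocity_x u]"
  | "euler_flux \<gamma> Dir_y u = vector
       [density u * velocity_y u,
        density u * velocity_x u * velocity_y u,
        density u * (velocity_y u)\<^sup>2 + pressure \<gamma> u,
        (u $ 4 + pressure \<gamma> u) * velocity_y u]"

definition specific_entropy :: "real \<Rightarrow> state \<Rightarrow> real"
  where "specific_entropy \<gamma> u = ln (pressure \<gamma> u / density u powr \<gamma>)"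

text \<open>The gradient of the entropy \<open>U = - \<rho> s / (\<gamma> - 1)\<close> with respect to the
  conserved variables.\<close>

definition entropy_vars :: "real \<Rightarrow> state \<Rightarrow> state"
  where "entropy_vars \<gamma> u = vector
     [\<gamma> / (\<gamma> - 1) - specific_entropy \<gamma> u / (\<gamma> - 1) - density u * speed_sq u / (2 * pressure \<gamma> u),
      density u * velocity_x u / pressure \<gamma> u,
      density u * velocity_y u / pressure \<gamma> u,
      - density u / pressure \<gamma> u]"

definition flux_potential :: "direction \<Rightarrow> state \<Rightarrow> real"
  where "flux_potential j u = density u * velocity j u"

text \<open>Means of a quantity \<open>a\<close> over the states \<open>u = u\<^sub>-\<close> and \<open>u' = u\<^sub>+\<close>.\<close>

definition arith_mean :: "(state \<Rightarrow> real) \<Rightarrow> state \<Rightarrow> state \<Rightarrow> real"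
  where "arith_mean a u u' = (a u + a u') / 2"

definition log_mean :: "(state \<Rightarrow> real) \<Rightarrow> state \<Rightarrow> state \<Rightarrow> real"
  where "log_mean a u u' = (if a u = a u' then a u else (a u' - a u) / (ln (a u') - ln (a u)))"

definition exp_mean :: "(state \<Rightarrow> real) \<Rightarrow> state \<Rightarrow> state \<Rightarrow> real"
  where "exp_mean a u u' =
    (if a u = a u' then a u else ln ((exp (a u') - exp (a u)) / (a u' - a u)))"

definition consistent_flux :: "real \<Rightarrow> direction \<Rightarrow> two_point_flux \<Rightarrow> bool"
  where "consistent_flux \<gamma> j f \<longleftrightarrow> (\<forall>u \<in> admissible \<gamma>. f u u = euler_flux \<gamma> j u)"

definition entropy_conservative :: "real \<Rightarrow> direction \<Rightarrow> two_point_flux \<Rightarrow> bool"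
  where "entropy_conservative \<gamma> j f \<longleftrightarrow>
    (\<forall>u \<in> admissible \<gamma>. \<forall>u' \<in> admissible \<gamma>.
       (entropy_vars \<gamma> u' - entropy_vars \<gamma> u) \<bullet> f u u'
         - (flux_potential j u' - flux_potential j u) = 0)"

definition consistent_pressure :: "real \<Rightarrow> (state \<Rightarrow> state \<Rightarrow> real) \<Rightarrow> bool"
  where "consistent_pressure \<gamma> pnum \<longleftrightarrow> (\<forall>u \<in> admissible \<gamma>. pnum u u = pressure \<gamma> u)"

text \<open>The numerical pressure \<open>pnum\<close> is kept as an argument, so that the claim exhibits it.\<close>

definition kinetic_energy_preserving ::
    "real \<Rightarrow> direction \<Rightarrow> (state \<Rightarrow> state \<Rightarrow> real) \<Rightarrow> two_point_flux \<Rightarrow> bool"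
  where "kinetic_energy_preserving \<gamma> j pnum f \<longleftrightarrow>
    consistent_pressure \<gamma> pnum \<and>
    (\<forall>u \<in> admissible \<gamma>. \<forall>u' \<in> admissible \<gamma>.
       momentum_component j (f u u') = arith_mean (velocity j) u u' * f u u' $ 1 + pnum u u')"

definition rho_over_p :: "real \<Rightarrow> state \<Rightarrow> real"
  where "rho_over_p \<gamma> u = density u / pressure \<gamma> u"

definition chi :: "real \<Rightarrow> state \<Rightarrow> real"
  where "chi \<gamma> u = ln (rho_over_p \<gamma> u)"

definition num_pressure :: "real \<Rightarrow> state \<Rightarrow> state \<Rightarrow> real"
  where "num_pressure \<gamma> u u' = arith_mean density u u' / arith_mean (rho_over_p \<gamma>) u u'"

definition num_energy_flux ::
    "real \<Rightarrow> state \<Rightarrow> state \<Rightarrow> real \<Rightarrow> real \<Rightarrow> real \<Rightarrow> real"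
  where "num_energy_flux \<gamma> u u' f\<rho> fx fy =
    (1 / (\<gamma> - 1) * (1 / exp (exp_mean (chi \<gamma>) u u'))
       - (arith_mean (\<lambda>u. (velocity_x u)\<^sup>2) u u' + arith_mean (\<lambda>u. (velocity_y u)\<^sup>2) u u') / 2) * f\<rho>
     + arith_mean velocity_x u u' * fx + arith_mean velocity_y u u' * fy"

fun num_flux :: "real \<Rightarrow> direction \<Rightarrow> two_point_flux"
  where
    "num_flux \<gamma> Dir_x u u' =
      (let f\<rho> = log_mean density u u' * arith_mean velocity_x u u';
           fx = arith_mean velocity_x u u' * f\<rho> + num_pressure \<gamma> u u';
           fy = arith_mean velocity_y u u' * f\<rho>
       in vector [f\<rho>, fx, fy, num_energy_flux \<gamma> u u' f\<rho> fx fy])"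
  | "num_flux \<gamma> Dir_y u u' =
      (let f\<rho> = log_mean density u u' * arith_mean velocity_y u u';
           fx = arith_mean velocity_x u u' * f\<rho>;
           fy = arith_mean velocity_y u u' * f\<rho> + num_pressure \<gamma> u u'
       in vector [f\<rho>, fx, fy, num_energy_flux \<gamma> u u' f\<rho> fx fy])"

end

theory Submission
  imports Defs
begin

text \<open>In the variables \<open>\<rho>\<close>, \<open>v\<close> and \<open>\<beta> = \<rho> / p = exp \<chi>\<close>, the first entropy variable is, up to a
  constant, \<open>ln \<rho> + \<chi> / (\<gamma> - 1) - \<beta> v\<^sup>2 / 2\<close>. The logarithmic mean turns the jump of \<open>ln \<rho>\<close> into the
  jump of \<open>\<rho>\<close>, and the exponential mean turns the jump of \<open>\<chi>\<close> into the jump of \<open>\<beta>\<close>. The discrete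
  product rule then reduces \<open>[w] \<cdot> f\<close> to \<open>{\<rho>} [v] + [\<rho>] {v} = [\<rho> v]\<close>.\<close>

lemma vector_4 [simp]:
  "(vector [a, b, c, d] :: 'a::zero ^ 4) $ 1 = a"
  "(vector [a, b, c, d] :: 'a::zero ^ 4) $ 2 = b"
  "(vector [a, b, c, d] :: 'a::zero ^ 4) $ 3 = c"
  "(vector [a, b, c, d] :: 'a::zero ^ 4) $ 4 = d"
  by (simp_all add: vector_def)

lemma inner_vec_4:
  fixes v w :: "real ^ 4"
  shows "v \<bullet> w = v $ 1 * w $ 1 + v $ 2 * w $ 2 + v $ 3 * w $ 3 + v $ 4 * w $ 4"
  by (simp add: inner_vec_def sum_4)

text \<open>Clearing the denominator merges the two cases of the mean: equal values give 0 on both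
  sides, and distinct positive values have distinct logarithms.\<close>

lemma log_mean_times_ln_diff:
  assumes "a u > 0" "a u' > 0"
  shows "(ln (a u') - ln (a u)) * log_mean a u u' = a u' - a u"
  using assms by (simp add: log_mean_def)

lemma exp_mean_times_diff:
  "exp (exp_mean a u u') * (a u' - a u) = exp (a u') - exp (a u)"
proof (cases "a u = a u'")
  case False
  \<comment> \<open>Monotonicity of \<open>exp\<close> gives the sign, so that \<open>exp\<close>
    cancels the \<open>ln\<close> in the mean.\<close>
  have "(exp (a u') - exp (a u)) / (a u' - a u) > 0"
    using False by (cases "a u < a u'") (auto simp: zero_less_divide_iff)
  with False show ?thesis
    by (simp add: exp_mean_def)
qed simp

lemma exp_chi:
  assumes "u \<in> admissible \<gamma>"
  shows "exp (chi \<gamma> u) = rho_over_p \<gamma> u"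
  using assms by (simp add: chi_def rho_over_p_def admissible_def)

text \<open>With p = \<rho> / exp \<chi>, the logarithm of the pressure is ln \<rho> -
  \<chi>.\<close>

lemma specific_entropy_eq:
  assumes "u \<in> admissible \<gamma>"
  shows "specific_entropy \<gamma> u = (1 - \<gamma>) * ln (density u) - chi \<gamma> u"
  using assms
  by (simp add: specific_entropy_def chi_def rho_over_p_def admissible_def ln_div ln_powr
      algebra_simps)

lemma entropy_vars_eq:
  assumes "\<gamma> > 1" "u \<in> admissible \<gamma>"
  shows "entropy_vars \<gamma> u = vector
    [\<gamma> / (\<gamma> - 1) + ln (density u) + chi \<gamma> u / (\<gamma> - 1) - rho_over_p \<gamma> u * speed_sq u / 2,
     rho_over_p \<gamma> u * velocity_x u,
     rho_over_p \<gamma> u * velocity_y u,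
     - rho_over_p \<gamma> u]"
proof -
  have "specific_entropy \<gamma> u / (\<gamma> - 1) = - ln (density u) - chi \<gamma> u / (\<gamma> - 1)"
    using assms by (simp add: specific_entropy_eq field_simps)
  then show ?thesis
    by (simp add: entropy_vars_def rho_over_p_def vec_eq_iff forall_4)
qed

text \<open>Here \<open>q\<^sub>x, q\<^sub>y\<close> are the pressure contributions to the two momentum fluxes.\<close>

lemma entropy_jump_identity:
  fixes b b' c E L m x x' y y' :: real
  assumes "h' - h = E * (b' - b)"
    and "fx = (x + x') / 2 * m + qx" "fy = (y + y') / 2 * m + qy"
  shows "((L + c * (h' - h)) - (b' * (x'\<^sup>2 + y'\<^sup>2) - b * (x\<^sup>2 + y\<^sup>2)) / 2) * m
      + (b' * x' - b * x) * fx + (b' * y' - b * y) * fy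
      - (b' - b) * ((c * E - ((x\<^sup>2 + x'\<^sup>2) / 2 + (y\<^sup>2 + y'\<^sup>2) / 2) / 2) * m
          + (x + x') / 2 * fx + (y + y') / 2 * fy)
    = L * m + (b + b') / 2 * ((x' - x) * qx + (y' - y) * qy)"
  \<comment> \<open>By the product rule for jumps, [b x] = {b} [x] + {x} [b] and [b x^2] / 2 = {b}
    {x} [x] + {x^2} [b] / 2. All terms in [b] cancel against the energy flux, leaving {b} [x] (fx -
    {x} m) = {b} [x] qx, and likewise for y.\<close>
  unfolding assms by (simp add: field_simps power2_eq_square)

lemma entropy_conservative_num_flux:
  assumes "\<gamma> > 1"
  shows "entropy_conservative \<gamma> j (num_flux \<gamma> j)"
  unfolding entropy_conservative_def
proof (intro ballI)
  fix u u' assume u: "u \<in> admissible \<gamma>" and u': "u' \<in> admissible \<gamma>"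
  let ?m = "num_flux \<gamma> j u u' $ 1" and ?p = "num_pressure \<gamma> u u'"
  let ?b = "rho_over_p \<gamma> u" and ?b' = "rho_over_p \<gamma> u'"
  let ?L = "ln (density u') - ln (density u)"
  let ?E = "1 / exp (exp_mean (chi \<gamma>) u u')"
  have pos: "density u > 0" "density u' > 0" "?b > 0" "?b' > 0"
    using u u' by (auto simp: admissible_def rho_over_p_def)
  have chi_jump: "chi \<gamma> u' - chi \<gamma> u = ?E * (?b' - ?b)"
    using exp_mean_times_diff[of "chi \<gamma>" u u'] by (simp add: exp_chi u u' field_simps)
  have mass: "?L * ?m = (density u' - density u) * arith_mean (velocity j) u u'"
    using log_mean_times_ln_diff[of density u u'] pos
    by (cases j) (simp_all add: Let_def arith_mean_def)
  \<comment> \<open>The quotient form of the numerical pressure turns its product with the mean of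
    \<rho> / p into the mean of \<rho>.\<close>
  have "arith_mean (rho_over_p \<gamma>) u u' \<noteq> 0"
    using pos by (simp add: arith_mean_def)
  then have "arith_mean (rho_over_p \<gamma>) u u' * ?p = arith_mean density u u'"
    by (simp add: num_pressure_def)
  then have p: "(?b + ?b') / 2 * ?p = (density u + density u') / 2"
    by (simp only: arith_mean_def)
  \<comment> \<open>Placing the pressure in the component of direction \<open>j\<close> lets one
    computation serve both fluxes.\<close>
  define qx where "qx = (if j = Dir_x then ?p else 0)"
  define qy where "qy = (if j = Dir_y then ?p else 0)"
  have fx: "num_flux \<gamma> j u u' $ 2 = (velocity_x u + velocity_x u') / 2 * ?m + qx"
    and fy: "num_flux \<gamma> j u u' $ 3 = (velocity_y u + velocity_y u') / 2 * ?m + qy"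
    by (cases j; simp add: qx_def qy_def Let_def arith_mean_def)+
  have fe: "num_flux \<gamma> j u u' $ 4
    = num_energy_flux \<gamma> u u' ?m (num_flux \<gamma> j u u' $ 2) (num_flux \<gamma> j u u' $ 3)"
    by (cases j) (simp_all add: Let_def)
  have q: "(velocity_x u' - velocity_x u) * qx + (velocity_y u' - velocity_y u) * qy
    = (velocity j u' - velocity j u) * ?p"
    by (cases j) (simp_all add: qx_def qy_def)
  have "(entropy_vars \<gamma> u' - entropy_vars \<gamma> u) \<bullet> num_flux \<gamma> j u u'
    = ?L * ?m + (?b + ?b') / 2 * ((velocity j u' - velocity j u) * ?p)"
    using entropy_jump_identity[OF chi_jump fx fy, of ?L "1 / (\<gamma> - 1)", unfolded q]
    by (simp add: inner_vec_4 entropy_vars_eq[OF assms] u u' fe num_energy_flux_def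
        arith_mean_def speed_sq_def diff_divide_distrib algebra_simps)
  also have "\<dots> = (density u' - density u) * arith_mean (velocity j) u u'
      + (density u + density u') / 2 * (velocity j u' - velocity j u)"
    unfolding mass p[symmetric] by (simp only: mult_ac)
  also have "\<dots> = flux_potential j u' - flux_potential j u"
    by (simp add: flux_potential_def arith_mean_def field_simps)
  finally show "(entropy_vars \<gamma> u' - entropy_vars \<gamma> u) \<bullet> num_flux \<gamma> j u u'
      - (flux_potential j u' - flux_potential j u) = 0"
    by simp
qed

lemma num_pressure_same:
  assumes "u \<in> admissible \<gamma>"
  shows "num_pressure \<gamma> u u = pressure \<gamma> u"
  using assms by (simp add: num_pressure_def arith_mean_def rho_over_p_def admissible_def)

lemma kinetic_energy_preserving_num_flux:
  "kinetic_energy_preserving \<gamma> j (num_pressure \<gamma>) (num_flux \<gamma> j)"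
  by (cases j)
    (simp_all add: kinetic_energy_preserving_def consistent_pressure_def num_pressure_same
      arith_mean_def Let_def)

text \<open>Solving the pressure law for the energy makes the energy fluxes comparable.\<close>

lemma energy_eq:
  assumes "\<gamma> > 1"
  shows "u $ 4 = pressure \<gamma> u / (\<gamma> - 1) + density u * speed_sq u / 2"
  using assms by (simp add: pressure_def)

lemma consistent_num_flux:
  assumes "\<gamma> > 1"
  shows "consistent_flux \<gamma> j (num_flux \<gamma> j)"
  unfolding consistent_flux_def
proof
  fix u assume u: "u \<in> admissible \<gamma>"
  then have pos: "density u > 0" "pressure \<gamma> u > 0"
    by (auto simp: admissible_def)
  \<comment> \<open>Hence the first term of the energy flux is the specific internal energy p /
    ((\<gamma> - 1) \<rho>).\<close>
  have e: "exp (exp_mean (chi \<gamma>) u u) = density u / pressure \<gamma> u"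
    using u by (simp add: exp_mean_def exp_chi rho_over_p_def)
  show "num_flux \<gamma> j u u = euler_flux \<gamma> j u"
    using pos assms
    by (cases j)
      (simp_all add: e Let_def num_energy_flux_def log_mean_def arith_mean_def num_pressure_same[OF u]
        energy_eq[OF assms, of u] speed_sq_def vec_eq_iff forall_4 power2_eq_square field_simps)
qed

theorem mainTheorem9:
  fixes \<gamma> :: real
  assumes "\<gamma> > 1"
  shows "\<forall>j. entropy_conservative \<gamma> j (num_flux \<gamma> j)
           \<and> kinetic_energy_preserving \<gamma> j (num_pressure \<gamma>) (num_flux \<gamma> j)
           \<and> consistent_flux \<gamma> j (num_flux \<gamma> j)"
  using assms
  by (simp add: entropy_conservative_num_flux kinetic_energy_preserving_num_flux consistent_num_flux)

end
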